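(* For any fixed $\tau\in\mathbb{R}$, any fixed $\varepsilon>0$ and any sufficiently large $N$ there exists a choice of signs $(s_n)_{n\le N}\in\{-1,1\}^N$ such that $$\left|\sum_{n\le N}\frac{s_n}{n} - \tau\right| \ll_{\tau,\varepsilon} \exp\left(-N^{1/3-\varepsilon}\right).$$
   Context: The sum is over all positive integers $n\le N$. The notation $\ll_{\tau,\varepsilon}$ means that the left side is at most a constant, depending only on $\tau$ and $\varepsilon$, times the right side. *)

theory Defs
  imports Complex_Main
begin

end

theory Submission
  imports Defs "HOL-Number_Theory.Number_Theory" "HOL-Analysis.Harmonic_Numbers" "HOL-Real_Asymp.Real_Asymp"
begin

text \<open>
  Let \<open>P\<close> be the set of primes in \<open>[N powr (5/6), N]\<close>. Greedy signs outside \<open>P\<close> (no even number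
  lies in \<open>P\<close>) bring the sum within \<open>1 / (N - 1)\<close> of \<open>\<tau>\<close>. The signs on \<open>P\<close> are chosen so that
  the total error \<open>Y\<close> makes \<open>cos (pi Y / (2 N)) ^ (2 M)\<close> at least its mean over random signs, where
  \<open>M\<close> is about \<open>exp (N powr (1/3 - \<epsilon>/2))\<close>; this kernel is negligible unless \<open>Y\<close> is tiny.
  It is a convex combination of functions \<open>cos (pi u Y)\<close> with \<open>\<bar>u\<bar> \<le> M / N\<close>, so frequency \<open>u\<close>
  contributes to the mean a multiple of \<open>\<Prod>p\<in>P. cos (pi u / p)\<close>. Low frequencies contribute
  nonnegative amounts, frequency zero at least \<open>1 / (2 M + 1)\<close>. For a high frequency \<open>u\<close>, a prime
  \<open>p\<close> with \<open>u / p\<close> very close to an integer divides one of the integers within \<open>N powr (2/3)\<close> of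
  \<open>u\<close>. Each of these is at most \<open>M\<close>, hence has few prime factors in \<open>P\<close>, so by Chebyshev's
  bound most \<open>p \<in> P\<close> are not of this kind, and the product is \<open>O(1 / M\<^sup>2)\<close>.
\<close>

section \<open>A Chebyshev-type lower bound for the number of primes\<close>

text \<open>Induction via the recurrence of the Leibniz harmonic triangle, whose entries are
  \<open>1 / ((n + 1) * (n choose m))\<close>.\<close>

lemma Suc_mult_binomial_dvd:
  assumes "m \<le> n" "\<And>k. k \<in> {1..Suc n} \<Longrightarrow> k dvd (L::nat)"
  shows "Suc n * (n choose m) dvd L"
  using assms
proof (induction m arbitrary: n)
  case 0
  then show ?case by auto
next
  case (Suc m)
  obtain n' where n: "n = Suc n'" using Suc.prems(1) by (cases n) auto
  have "Suc n' * (n' choose m) dvd L"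
    using Suc.prems by (intro Suc.IH) (auto simp: n)
  then obtain z1 where z1: "L = Suc n' * (n' choose m) * z1" by (elim dvdE)
  have "Suc n * (n choose m) dvd L"
    using Suc.prems by (intro Suc.IH) auto
  then obtain z2 where z2: "L = Suc n * (n choose m) * z2" by (elim dvdE)
  define c where "c = int (n choose Suc m)"
  have a1: "int (Suc n' * (n' choose m)) = int (Suc m) * c"
    unfolding c_def n of_nat_mult[symmetric] of_nat_eq_iff
    by (rule Suc_times_binomial[symmetric])
  have "Suc m * (n choose Suc m) = (n - m) * (n choose m)"
    using binomial_absorption[of m n] binomial_absorb_comp[of n m] n
    by (metis Suc_times_binomial_eq diff_Suc_1 mult.commute)
  then have a2: "int (Suc m) * c = (int n - int m) * int (n choose m)"
    using Suc.prems(1) unfolding c_def by (simp flip: of_nat_mult of_nat_diff del: of_nat_Suc)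
  have e1: "int L = int (Suc m) * c * int z1"
    unfolding z1 of_nat_mult[of _ z1] a1 ..
  have e2: "(int n - int m) * int L = (int n + 1) * (int (Suc m) * c) * int z2"
    unfolding z2 a2 by (simp add: algebra_simps)
  \<comment> \<open>This is \<open>n + 1\<close> times \<open>e1\<close> minus \<open>e2\<close>,
    since \<open>m + 1 = (n + 1) - (n - m)\<close>. The difference of cofactors
    \<open>z1 - z2\<close> is why the argument passes to integers.\<close>
  have "int (Suc m) * int L = int (Suc m) * ((int n + 1) * c * (int z1 - int z2))"
    using e1 e2 by (simp add: algebra_simps)
  then have "int L = int (Suc n * (n choose Suc m)) * (int z1 - int z2)"
    unfolding c_def by (simp only: mult_cancel_left) (simp add: algebra_simps)
  then show ?case by (metis dvd_triv_left int_dvd_int_iff)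
qed

text \<open>The \<open>2 * m + 1\<close> entries of the row sum to \<open>4 ^ m\<close> and the
  middle one is largest. Needed both for counting primes and for the constant Fourier coefficient of
  the kernel.\<close>

lemma four_power_le_central_binomial: "4 ^ m \<le> Suc (2 * m) * ((2 * m) choose m)"
proof -
  have "(4::nat) ^ m = (\<Sum>k\<le>2*m. (2 * m) choose k)"
    by (simp add: choose_row_sum power_mult)
  also have "\<dots> \<le> (\<Sum>k\<le>2*m. (2 * m) choose m)"
    by (intro sum_mono) (metis binomial_maximum nonzero_mult_div_cancel_left zero_neq_numeral)
  finally show ?thesis by simp
qed

text \<open>The least common multiple of \<open>1, ..., n\<close> is squeezed: each prime
  contributes a power of size at most \<open>n\<close>, while a multiple of a central binomial
  coefficient divides it.\<close>

lemma two_power_le_power_prime_count: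
  fixes n :: nat
  assumes "n \<ge> 1"
  shows "2 ^ (n - 2) \<le> n ^ card {p. prime p \<and> p \<le> n}"
proof -
  define P where "P = {p. prime p \<and> p \<le> n}"
  have finP: "finite P" unfolding P_def by (rule finite_subset[of _ "{..n}"]) auto
  \<comment> \<open>\<open>p ^ e p\<close> is the largest power of \<open>p\<close> up to
    \<open>n\<close>, so \<open>L\<close> below is the least common multiple of
    \<open>1, ..., n\<close>.\<close>
  define e where "e p = Max {i. p ^ i \<le> n}" for p :: nat
  define L where "L = (\<Prod>p\<in>P. p ^ e p)"
  have fin: "finite {i. p ^ i \<le> n}" if "p \<in> P" for p
  proof (rule finite_subset[of _ "{..n}"])
    have "i < p ^ i" for i using that prime_gt_1_nat[of p] by (intro power_gt_expt) (auto simp: P_def)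
    then show "{i. p ^ i \<le> n} \<subseteq> {..n}" by (auto intro: less_imp_le order.strict_trans2)
  qed auto
  have e_le: "p ^ e p \<le> n" if "p \<in> P" for p
  proof -
    have "0 \<in> {i. p ^ i \<le> n}" using assms by simp
    then have "e p \<in> {i. p ^ i \<le> n}" unfolding e_def using fin[OF that] by (intro Max_in) blast+
    then show ?thesis by simp
  qed
  have dvd: "k dvd L" if k: "k \<in> {1..n}" for k
  proof -
    have k0: "k \<noteq> 0" "k \<le> n" using k by auto
    have sub: "prime_factors k \<subseteq> P"
      using k0 by (auto simp: P_def prime_factors_dvd dest: dvd_imp_le)
    have "k = (\<Prod>p\<in>prime_factors k. p ^ multiplicity p k)"
      using prime_factorization_nat[of k] k0 by simp
    also have "\<dots> dvd (\<Prod>p\<in>prime_factors k. p ^ e p)"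
    proof (rule prod_dvd_prod, rule le_imp_power_dvd)
      fix p assume p: "p \<in> prime_factors k"
      have "p ^ multiplicity p k \<le> k" using k0 by (intro dvd_imp_le multiplicity_dvd) auto
      then show "multiplicity p k \<le> e p"
        unfolding e_def using k0 fin p sub by (intro Max_ge) auto
    qed
    also have "\<dots> dvd L" unfolding L_def by (rule prod_dvd_prod_subset[OF finP sub])
    finally show ?thesis .
  qed
  \<comment> \<open>The largest \<open>m\<close> with \<open>2 * m + 1 \<le> n\<close>; it satisfies
    \<open>n - 2 \<le> 2 * m\<close>.\<close>
  define m where "m = (n - 1) div 2"
  have "Suc (2 * m) * ((2 * m) choose m) dvd L"
    using assms by (intro Suc_mult_binomial_dvd dvd) (auto simp: m_def)
  moreover have "L > 0" unfolding L_def P_def by (intro prod_pos) (auto simp: prime_gt_0_nat)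
  ultimately have "Suc (2 * m) * ((2 * m) choose m) \<le> L" by (rule dvd_imp_le)
  have "(2::nat) ^ (n - 2) \<le> 2 ^ (2 * m)"
    by (intro power_increasing) (auto simp: m_def)
  also have "\<dots> = 4 ^ m" by (simp add: power_mult)
  also have "\<dots> \<le> L"
    using four_power_le_central_binomial \<open>_ \<le> L\<close> by (rule order.trans)
  also have "L \<le> (\<Prod>p\<in>P. n)" unfolding L_def using e_le by (intro prod_mono) auto
  finally show ?thesis by (simp add: P_def)
qed

lemma prime_count_ge:
  assumes "n \<ge> 2"
  shows "real (card {p. prime p \<and> p \<le> n}) \<ge> (real n - 2) * ln 2 / ln (real n)"
proof -
  have "real (2 ^ (n - 2)) \<le> real (n ^ card {p. prime p \<and> p \<le> n})"
    using two_power_le_power_prime_count[of n] assms by (subst of_nat_le_iff) auto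
  then have "ln (2 ^ (n - 2)) \<le> ln (real n ^ card {p. prime p \<and> p \<le> n})"
    using assms by (subst ln_le_cancel_iff) auto
  then show ?thesis using assms by (simp add: ln_realpow of_nat_diff divide_le_eq)
qed

section \<open>Greedy signs outside the set of primes\<close>

text \<open>Each sign moves the sum towards \<open>\<tau>\<close>. While the error exceeds the next
  term it drops by exactly that term, which the second entry of the maximum records; once comparable
  with the term it stays that small, which is the first entry. No two consecutive indices are
  missing from \<open>A\<close>, hence \<open>N - 1\<close> when \<open>N\<close> is
  skipped.\<close>

lemma greedy_signs:
  fixes A :: "nat set" and \<tau> :: real
  assumes even: "\<And>n. even n \<Longrightarrow> n \<in> A" and "N \<ge> 3"
  shows "\<exists>s :: nat \<Rightarrow> real. (\<forall>n. s n \<in> {-1, 1}) \<and>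
           \<bar>(\<Sum>n\<in>{1..N} \<inter> A. s n / real n) - \<tau>\<bar>
             \<le> max (if N \<in> A then 1 / real N else 1 / (real N - 1))
                   (\<bar>\<tau>\<bar> + 4 - (\<Sum>n\<in>{1..N} \<inter> A. 1 / real n))"
  using assms(2)
proof (induction N rule: nat_induct_at_least)
  case base
  define S where "S = (\<Sum>n\<in>{1..3} \<inter> A. 1 / real n)"
  have "S \<le> (\<Sum>n\<in>{1..3}. 1 / real n)" unfolding S_def by (intro sum_mono2) auto
  also have "\<dots> \<le> 2" by (simp add: numeral_3_eq_3)
  finally have "S \<le> 2" .
  \<comment> \<open>The 4 comes from here: the error is at most
    \<open>\<bar>\<tau>\<bar> + S\<close>, and \<open>2 * S \<le> 4\<close>.\<close>
  then have "\<bar>S - \<tau>\<bar> \<le> \<bar>\<tau>\<bar> + 4 - S"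
    by linarith
  then show ?case by (intro exI[of _ "\<lambda>_. 1"]) (simp add: S_def)
next
  case (Suc N)
  define S where "S N = (\<Sum>n\<in>{1..N} \<inter> A. 1 / real n)" for N
  define f where "f N = (if N \<in> A then 1 / real N else 1 / (real N - 1))" for N
  from Suc.IH obtain s :: "nat \<Rightarrow> real" where s: "\<And>n. s n \<in> {-1, 1}"
    and le: "\<bar>(\<Sum>n\<in>{1..N} \<inter> A. s n / real n) - \<tau>\<bar> \<le> max (f N) (\<bar>\<tau>\<bar> + 4 - S N)"
    unfolding S_def f_def by blast
  define D where "D = (\<Sum>n\<in>{1..N} \<inter> A. s n / real n) - \<tau>"
  show ?case
  proof (cases "Suc N \<in> A")
    case False
    then have "odd (Suc N)" using even by blast
    then have "N \<in> A" using even by simp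
    have eq: "{1..Suc N} \<inter> A = {1..N} \<inter> A" using False by (auto simp: le_Suc_eq)
    have "f (Suc N) = f N" using False \<open>N \<in> A\<close> by (simp add: f_def)
    then show ?thesis using s le unfolding S_def f_def eq by (intro exI[of _ s]) auto
  next
    case True
    have eq: "{1..Suc N} \<inter> A = insert (Suc N) ({1..N} \<inter> A)" using True by auto
    \<comment> \<open>Equivalent to \<open>N \<ge> 3\<close>. An error of at most two steps
      \<open>1 / (N + 1)\<close> becomes at most one step after the correction.\<close>
    have "1 / (real N - 1) \<le> 2 / (real N + 1)" using Suc.hyps by (simp add: field_simps)
    moreover have "1 / real N \<le> 1 / (real N - 1)" using Suc.hyps by (simp add: field_simps)
    ultimately have fN: "f N \<le> 2 / (real N + 1)" by (simp add: f_def)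
    have fS: "f (Suc N) = 1 / (real N + 1)" using True by (simp add: f_def add.commute)
    have SS: "S (Suc N) = S N + 1 / (real N + 1)"
      unfolding S_def eq by (subst sum.insert) (auto simp: add.commute)
    define \<sigma> :: real where "\<sigma> = (if D \<ge> 0 then - 1 else 1)"
    have "\<bar>D + \<sigma> / (real N + 1)\<bar> = \<bar>\<bar>D\<bar> - 1 / (real N + 1)\<bar>"
      by (auto simp: \<sigma>_def)
    also have "\<dots> \<le> max (f (Suc N)) (\<bar>\<tau>\<bar> + 4 - S (Suc N))"
      using le fN unfolding D_def[symmetric] fS SS
      by (auto simp: max_def abs_if split: if_splits)
    finally have *: "\<bar>D + \<sigma> / (real N + 1)\<bar> \<le> max (f (Suc N)) (\<bar>\<tau>\<bar> + 4 - S (Suc N))" .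
    have sm: "(\<Sum>n\<in>{1..N} \<inter> A. (s(Suc N := \<sigma>)) n / real n) = (\<Sum>n\<in>{1..N} \<inter> A. s n / real n)"
      by (intro sum.cong) auto
    have "(\<Sum>n\<in>{1..Suc N} \<inter> A. (s(Suc N := \<sigma>)) n / real n) - \<tau> = D + \<sigma> / (real N + 1)"
      unfolding eq by (subst sum.insert) (auto simp: D_def sm add.commute simp del: fun_upd_apply, simp)
    then show ?thesis using * s unfolding S_def f_def
      by (intro exI[of _ "s(Suc N := \<sigma>)"]) (simp add: \<sigma>_def)
  qed
qed

lemma sum_inverse_even_ge:
  fixes A :: "nat set"
  assumes even: "\<And>n. even n \<Longrightarrow> n \<in> A"
  shows "(\<Sum>n\<in>{1..N} \<inter> A. 1 / real n) \<ge> ln (real (Suc (N div 2))) / 2"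
proof -
  have "ln (real (Suc (N div 2))) / 2 \<le> harm (N div 2) / 2"
    using ln_le_harm[of "N div 2"] by (simp add: add.commute)
  also have "\<dots> = (\<Sum>k\<in>{1..N div 2}. 1 / real (2 * k))"
    by (simp add: harm_def sum_divide_distrib field_simps)
  also have "\<dots> = (\<Sum>n\<in>(*) 2 ` {1..N div 2}. 1 / real n)"
    by (subst sum.reindex) (auto simp: inj_on_def)
  also have "\<dots> \<le> (\<Sum>n\<in>{1..N} \<inter> A. 1 / real n)"
    using even by (intro sum_mono2) auto
  finally show ?thesis .
qed

text \<open>The harmonic sum over even numbers already diverges, so the threshold for
  \<open>N\<close> is uniform in \<open>A\<close>. This matters because \<open>A\<close> will be
  chosen depending on \<open>N\<close>.\<close>

lemma greedy_signs_small_error: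
  "\<forall>\<^sub>F N in sequentially. \<forall>A. (\<forall>n. even n \<longrightarrow> n \<in> A) \<longrightarrow>
     (\<exists>s :: nat \<Rightarrow> real. (\<forall>n. s n \<in> {-1, 1}) \<and>
        \<bar>(\<Sum>n\<in>{1..N} \<inter> A. s n / real n) - \<tau>\<bar> \<le> 1 / (real N - 1))"
proof -
  have "filterlim (\<lambda>N. ln (real (Suc (N div 2))) / 2) at_top sequentially"
    by real_asymp
  then have "\<forall>\<^sub>F N in sequentially. ln (real (Suc (N div 2))) / 2 \<ge> \<bar>\<tau>\<bar> + 4"
    unfolding filterlim_at_top by blast
  then show ?thesis
    using eventually_ge_at_top[of 3]
  proof eventually_elim
    case (elim N)
    show ?case
    proof (intro allI impI)
      fix A :: "nat set" assume "\<forall>n. even n \<longrightarrow> n \<in> A"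
      then have A: "\<And>n. even n \<Longrightarrow> n \<in> A" by blast
      have S: "\<bar>\<tau>\<bar> + 4 - (\<Sum>n\<in>{1..N} \<inter> A. 1 / real n) \<le> 0"
        using sum_inverse_even_ge[OF A, of N] elim by simp
      have N: "0 \<le> 1 / (real N - 1)" "1 / real N \<le> 1 / (real N - 1)"
        using elim by (simp_all add: field_simps)
      have "max (if N \<in> A then 1 / real N else 1 / (real N - 1))
          (\<bar>\<tau>\<bar> + 4 - (\<Sum>n\<in>{1..N} \<inter> A. 1 / real n)) \<le> 1 / (real N - 1)"
        using N(2) by (intro max.boundedI order.trans[OF S N(1)]) auto
      then show "\<exists>s :: nat \<Rightarrow> real. (\<forall>n. s n \<in> {-1, 1}) \<and>
        \<bar>(\<Sum>n\<in>{1..N} \<inter> A. s n / real n) - \<tau>\<bar> \<le> 1 / (real N - 1)"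
        using greedy_signs[OF A elim(2), where \<tau> = \<tau>] by (meson order.trans)
    qed
  qed
qed

section \<open>Cosine estimates and the choice of signs by averaging\<close>

text \<open>Up to \<open>1 / 3\<close> the mean value theorem applies, with derivative at least
  \<open>cos (pi / 3) = 1 / 2\<close> and \<open>pi \<ge> 2\<close>; beyond it the sine is at least
  \<open>sin (pi / 6) = 1 / 2\<close>.\<close>

lemma sin_pi_mult_ge:
  assumes "0 \<le> w" "w \<le> 1 / 2"
  shows "w \<le> sin (pi * w)"
proof (cases "w \<le> 1 / 3")
  case True
  show ?thesis
  proof (cases "w = 0")
    case False
    then have pos: "0 < pi * w" using assms by simp
    obtain z where z: "0 < z" "z < pi * w" "sin (pi * w) - sin 0 = (pi * w - 0) * cos z"
      using MVT2[OF pos, of sin cos] by auto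
    have "pi * w \<le> pi * (1 / 3)" using True by (intro mult_left_mono) auto
    then have "z \<le> pi / 3" using z(2) by linarith
    then have "cos (pi / 3) \<le> cos z" using z(1) by (intro cos_monotone_0_pi_le) auto
    then have "pi * w * (1 / 2) \<le> pi * w * cos z"
      using pos by (intro mult_left_mono) (auto simp: cos_60)
    then have "pi * w * (1 / 2) \<le> sin (pi * w)" using z(3) by simp
    moreover have "2 * w \<le> pi * w" using pi_ge_two assms by (intro mult_right_mono) auto
    ultimately show ?thesis by linarith
  qed auto
next
  case False
  have "pi * w \<le> pi * (1 / 2)" using assms by (intro mult_left_mono) auto
  moreover have "pi * (1 / 6) \<le> pi * w" using False by (intro mult_left_mono) auto
  ultimately have "sin (pi / 6) \<le> sin (pi * w)"
    by (intro sin_monotone_2pi_le) auto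
  then show ?thesis using assms by (simp add: sin_30)
qed

lemma cos_squared_le_exp:
  assumes "\<bar>w\<bar> \<le> 1 / 2"
  shows "cos (pi * w) ^ 2 \<le> exp (- (w\<^sup>2))"
proof -
  have "\<bar>w\<bar> ^ 2 \<le> sin (pi * \<bar>w\<bar>) ^ 2"
    using assms by (intro power_mono sin_pi_mult_ge) auto
  also have "\<dots> = sin (pi * w) ^ 2" by (cases "w \<ge> 0") auto
  finally have "w\<^sup>2 \<le> (sin (pi * w))\<^sup>2" by simp
  then have "cos (pi * w) ^ 2 \<le> 1 + (- (w\<^sup>2))" by (simp add: cos_squared_eq)
  also have "\<dots> \<le> exp (- (w\<^sup>2))" by (rule exp_ge_add_one_self)
  finally show ?thesis .
qed

text \<open>\<open>\<bar>cos (pi * v)\<bar>\<close> has period 1, so \<open>v\<close> may be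
  replaced by its offset from the nearest integer.\<close>

lemma abs_cos_pi_le_exp:
  assumes "0 \<le> d" "\<And>m::int. d \<le> \<bar>v - of_int m\<bar>"
  shows "\<bar>cos (pi * v)\<bar> \<le> exp (- (d\<^sup>2 / 2))"
proof -
  define w where "w = v - of_int (round v)"
  have "d\<^sup>2 \<le> \<bar>w\<bar>\<^sup>2"
    using assms unfolding w_def by (intro power_mono) auto
  have "cos (pi * v) = cos (pi * w + pi * of_int (round v))"
    by (simp add: w_def algebra_simps)
  also have "\<dots> = cos (pi * w) * cos (pi * of_int (round v))"
    by (simp add: cos_add)
  finally have "cos (pi * v) ^ 2 = cos (pi * w) ^ 2 * cos (pi * of_int (round v)) ^ 2"
    by (simp add: power_mult_distrib)
  also have "cos (pi * of_int (round v)) ^ 2 = (1::real)"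
    by (simp add: cos_squared_eq)
  also have "cos (pi * w) ^ 2 * 1 \<le> exp (- (w\<^sup>2))"
    using cos_squared_le_exp[of w] of_int_round_abs_le[of v]
    by (simp add: w_def abs_minus_commute)
  also have "\<dots> \<le> exp (- d\<^sup>2)" using \<open>d\<^sup>2 \<le> _\<close> by simp
  also have "\<dots> = exp (- (d\<^sup>2 / 2)) ^ 2" by (simp add: exp_of_nat_mult[symmetric])
  finally show ?thesis
    using abs_le_square_iff[of "cos (pi * v)" "exp (- (d\<^sup>2 / 2))"] by simp
qed

lemma two_cos_power:
  "(2 * cos u) ^ n = (\<Sum>k\<le>n. real (n choose k) * cos ((2 * real k - real n) * u))"
proof -
  have "of_real ((2 * cos u) ^ n) = (cis u + cis (- u)) ^ n"
  proof -
    have "cis u + cis (- u) = of_real (2 * cos u)" by (simp add: complex_eq_iff)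
    then show ?thesis by (simp only: of_real_power)
  qed
  also have "\<dots> = (\<Sum>k\<le>n. of_nat (n choose k) * cis u ^ k * cis (- u) ^ (n - k))"
    by (rule binomial_ring)
  also have "\<dots> = (\<Sum>k\<le>n. of_nat (n choose k) * cis ((2 * real k - real n) * u))"
  proof (intro sum.cong refl)
    fix k assume "k \<in> {..n}"
    then have "real k * u + real (n - k) * (- u) = (2 * real k - real n) * u"
      by (simp add: of_nat_diff algebra_simps)
    then show "of_nat (n choose k) * cis u ^ k * cis (- u) ^ (n - k)
        = of_nat (n choose k) * cis ((2 * real k - real n) * u)"
      by (simp only: Complex.DeMoivre mult.assoc cis_mult)
  qed
  finally have "Re (of_real ((2 * cos u) ^ n)) = Re \<dots>" by (rule arg_cong)
  then show ?thesis by simp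
qed

text \<open>The left-hand side is the mean of the right-hand side over all sign choices; the signs are found
  one at a time by the method of conditional expectations.\<close>

lemma exists_signs_cos_sum_ge:
  fixes c \<omega> :: "'i \<Rightarrow> real" and g :: "'a \<Rightarrow> real"
  assumes "finite P"
  shows "\<exists>s :: 'a \<Rightarrow> real. (\<forall>p. s p \<in> {-1, 1}) \<and>
    (\<Sum>j\<in>J. c j * cos (\<omega> j * y) * (\<Prod>p\<in>P. cos (\<omega> j * g p)))
      \<le> (\<Sum>j\<in>J. c j * cos (\<omega> j * (y + (\<Sum>p\<in>P. s p * g p))))"
  using assms
proof (induction P arbitrary: y)
  case empty
  show ?case by (intro exI[of _ "\<lambda>_. 1"]) simp
next
  case (insert q P)
  define G where "G y = (\<Sum>j\<in>J. c j * cos (\<omega> j * y) * (\<Prod>p\<in>P. cos (\<omega> j * g p)))" for y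
  have "(\<Sum>j\<in>J. c j * cos (\<omega> j * y) * (\<Prod>p\<in>insert q P. cos (\<omega> j * g p)))
      = (\<Sum>j\<in>J. c j * (cos (\<omega> j * y) * cos (\<omega> j * g q)) * (\<Prod>p\<in>P. cos (\<omega> j * g p)))"
    using insert.hyps by (simp add: mult_ac)
  \<comment> \<open>The product formula turns the factor for \<open>q\<close> into the average over
    its two signs; the better sign does at least as well.\<close>
  also have "\<dots> = (G (y + g q) + G (y - g q)) / 2"
    unfolding G_def cos_times_cos sum.distrib[symmetric] sum_divide_distrib
    by (intro sum.cong) (auto simp: algebra_simps add_divide_distrib)
  also have "\<dots> \<le> max (G (y + 1 * g q)) (G (y + (-1) * g q))" by simp
  finally obtain \<sigma> :: real where \<sigma>: "\<sigma> \<in> {-1, 1}"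
    and le: "(\<Sum>j\<in>J. c j * cos (\<omega> j * y) * (\<Prod>p\<in>insert q P. cos (\<omega> j * g p))) \<le> G (y + \<sigma> * g q)"
    by (fastforce simp: max_def split: if_splits)
  obtain s :: "'a \<Rightarrow> real" where s: "\<And>p. s p \<in> {-1, 1}"
    "G (y + \<sigma> * g q) \<le> (\<Sum>j\<in>J. c j * cos (\<omega> j * (y + \<sigma> * g q + (\<Sum>p\<in>P. s p * g p))))"
    using insert.IH[of "y + \<sigma> * g q"] unfolding G_def by blast
  have "(\<Sum>p\<in>P. (s(q := \<sigma>)) p * g p) = (\<Sum>p\<in>P. s p * g p)"
    using insert.hyps by (intro sum.cong) auto
  then have eq: "y + \<sigma> * g q + (\<Sum>p\<in>P. s p * g p) = y + (\<Sum>p\<in>insert q P. (s(q := \<sigma>)) p * g p)"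
    using insert.hyps by simp
  show ?case using order.trans[OF le s(2)] s(1) \<sigma> unfolding eq
    by (intro exI[of _ "s(q := \<sigma>)"] conjI allI) simp_all
qed

section \<open>Products of cosines over primes at high frequency\<close>

lemma card_prime_divisors_le:
  fixes P :: "nat set" and k :: nat
  assumes "finite P" "\<And>p. p \<in> P \<Longrightarrow> prime p \<and> Q \<le> real p \<and> p dvd k" "k > 0" "Q > 0"
  shows "real (card P) * ln Q \<le> ln (real k)"
proof -
  have "\<Prod>P dvd k"
    using assms(1,2)
  proof (induction P)
    case (insert p P)
    have "coprime p (\<Prod>P)"
      using insert by (intro prod_coprime_right) (metis insertCI primes_coprime)
    then show ?case using insert by (simp add: divides_mult)
  qed auto
  then have "\<Prod>P \<le> k" using assms(3) by (intro dvd_imp_le)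
  have "Q ^ card P = (\<Prod>p\<in>P. Q)" by simp
  also have "\<dots> \<le> (\<Prod>p\<in>P. real p)" using assms by (intro prod_mono) auto
  also have "\<dots> \<le> real k" using \<open>\<Prod>P \<le> k\<close> by (simp flip: of_nat_prod)
  finally have "ln (Q ^ card P) \<le> ln (real k)" using assms by (subst ln_le_cancel_iff) auto
  then show ?thesis using assms by (simp add: ln_realpow)
qed

text \<open>Such a prime divides an integer in \<open>[u - y, u + y]\<close>. There are at most
  \<open>2 * y + 1\<close> of these integers, and each has at most \<open>ln X\<close> prime factors
  from \<open>P\<close> because \<open>ln Q \<ge> 1\<close>.\<close>

lemma card_primes_near_multiple_le:
  fixes P :: "nat set" and u y X Q :: real
  assumes "finite P" "\<And>p. p \<in> P \<Longrightarrow> prime p \<and> Q \<le> real p" "1 \<le> ln Q" "Q > 0"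
    and "0 \<le> y" "y < u" "u + y \<le> X" "1 \<le> X"
  shows "real (card {p \<in> P. \<exists>m::int. \<bar>u - of_int m * real p\<bar> < y}) \<le> (2 * y + 1) * ln X"
proof -
  define I where "I = {\<lceil>u - y\<rceil>..\<lfloor>u + y\<rfloor>}"
  have I: "real (card I) \<le> 2 * y + 1"
    using assms by (simp add: I_def) linarith
  \<comment> \<open>Positivity, from \<open>y < u\<close>, keeps out 0, which every prime
    divides.\<close>
  have pos: "0 < k \<and> of_int k \<le> X" if "k \<in> I" for k
  proof -
    have "u - y \<le> of_int k" "of_int k \<le> u + y" using that by (auto simp: I_def ceiling_le_iff le_floor_iff)
    moreover from this have "(0::real) < of_int k" using assms by linarith
    ultimately show ?thesis using assms by auto
  qed
  have "{p \<in> P. \<exists>m::int. \<bar>u - of_int m * real p\<bar> < y} \<subseteq> (\<Union>k\<in>I. {p \<in> P. int p dvd k})"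
  proof clarify
    fix p m assume p: "p \<in> P" "\<bar>u - of_int m * real p\<bar> < y"
    have "m * int p \<in> I" using p(2) unfolding I_def by (auto simp: ceiling_le_iff le_floor_iff)
    then show "p \<in> (\<Union>k\<in>I. {p \<in> P. int p dvd k})" using p(1) by (intro UN_I[of "m * int p"]) auto
  qed
  then have "card {p \<in> P. \<exists>m::int. \<bar>u - of_int m * real p\<bar> < y} \<le> card (\<Union>k\<in>I. {p \<in> P. int p dvd k})"
    using assms(1) by (intro card_mono finite_UN_I) (auto simp: I_def)
  also have "\<dots> \<le> (\<Sum>k\<in>I. card {p \<in> P. int p dvd k})" by (intro card_UN_le) (simp add: I_def)
  finally have "real (card {p \<in> P. \<exists>m::int. \<bar>u - of_int m * real p\<bar> < y})
      \<le> (\<Sum>k\<in>I. real (card {p \<in> P. int p dvd k}))"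
    by (simp flip: of_nat_sum)
  also have "\<dots> \<le> (\<Sum>k\<in>I. ln X)"
  proof (rule sum_mono)
    fix k assume k: "k \<in> I"
    have "real (card {p \<in> P. int p dvd k}) * 1 \<le> real (card {p \<in> P. int p dvd k}) * ln Q"
      using assms(3) by (intro mult_left_mono) auto
    also have "\<dots> \<le> ln (real (nat k))"
    proof (rule card_prime_divisors_le)
      fix p assume "p \<in> {p \<in> P. int p dvd k}"
      moreover have "int p dvd int (nat k)" if "int p dvd k" using that pos[OF k] by simp
      ultimately show "prime p \<and> Q \<le> real p \<and> p dvd nat k"
        using assms(2) by (simp only: int_dvd_int_iff mem_Collect_eq)
    qed (use assms pos[OF k] in auto)
    also have "\<dots> \<le> ln X" using pos[OF k] by (simp add: ln_mono)
    finally show "real (card {p \<in> P. int p dvd k}) \<le> ln X" by simp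
  qed
  also have "\<dots> = real (card I) * ln X" by simp
  also have "\<dots> \<le> (2 * y + 1) * ln X"
    using I assms by (intro mult_right_mono) auto
  finally show ?thesis .
qed

text \<open>Exceptional primes contribute factors at most 1. For any other \<open>p\<close>,
  \<open>u / p\<close> is at least \<open>y / p \<ge> y / R\<close> away from every integer.\<close>

lemma prod_abs_cos_le_exp:
  fixes P :: "nat set" and u y X Q R :: real
  assumes "finite P" "\<And>p. p \<in> P \<Longrightarrow> prime p \<and> Q \<le> real p \<and> real p \<le> R" "1 \<le> ln Q" "Q > 0"
    and "0 \<le> y" "y < u" "u + y \<le> X" "1 \<le> X"
  shows "(\<Prod>p\<in>P. \<bar>cos (pi * (u / real p))\<bar>)
           \<le> exp (- ((real (card P) - (2 * y + 1) * ln X) * ((y / R)\<^sup>2 / 2)))"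
proof -
  define E where "E = {p \<in> P. \<exists>m::int. \<bar>u - of_int m * real p\<bar> < y}"
  have E: "E \<subseteq> P" "finite E" using assms(1) by (auto simp: E_def)
  have "real (card E) \<le> (2 * y + 1) * ln X"
    unfolding E_def using assms by (intro card_primes_near_multiple_le[where Q = Q]) auto
  then have card: "real (card P) - (2 * y + 1) * ln X \<le> real (card (P - E))"
    using E assms(1) card_mono[OF assms(1) E(1)] by (simp add: card_Diff_subset of_nat_diff)
  have le: "\<bar>cos (pi * (u / real p))\<bar> \<le> exp (- ((y / R)\<^sup>2 / 2))" if p: "p \<in> P - E" for p
  proof (rule abs_cos_pi_le_exp)
    have pos: "0 < real p" "0 < R" "real p \<le> R" using p assms(2)[of p] assms(4) by auto
    then show "0 \<le> y / R" using assms by simp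
    fix m :: int
    have "y \<le> \<bar>u - of_int m * real p\<bar>" using p by (auto simp: E_def not_less)
    have "y / R \<le> y / real p" using pos assms by (intro divide_left_mono) auto
    also have "\<dots> \<le> \<bar>u - of_int m * real p\<bar> / real p"
      using \<open>y \<le> _\<close> pos by (intro divide_right_mono) auto
    also have "\<dots> = \<bar>(u - of_int m * real p) / real p\<bar>" using pos by simp
    also have "(u - of_int m * real p) / real p = u / real p - of_int m"
      using pos by (simp add: diff_divide_distrib)
    finally show "y / R \<le> \<bar>u / real p - of_int m\<bar>" .
  qed
  have "(\<Prod>p\<in>P. \<bar>cos (pi * (u / real p))\<bar>)
      = (\<Prod>p\<in>P - E. \<bar>cos (pi * (u / real p))\<bar>) * (\<Prod>p\<in>E. \<bar>cos (pi * (u / real p))\<bar>)"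
    using prod.subset_diff[OF E(1) assms(1)] .
  also have "\<dots> \<le> (\<Prod>p\<in>P - E. \<bar>cos (pi * (u / real p))\<bar>) * 1"
    by (intro mult_left_mono prod_le_1 prod_nonneg) auto
  also have "\<dots> \<le> (\<Prod>p\<in>P - E. exp (- ((y / R)\<^sup>2 / 2)))"
    using le by (simp only: mult_1_right) (intro prod_mono, auto)
  also have "\<dots> = exp (- (real (card (P - E)) * ((y / R)\<^sup>2 / 2)))"
    by (simp flip: exp_of_nat_mult)
  also have "\<dots> \<le> exp (- ((real (card P) - (2 * y + 1) * ln X) * ((y / R)\<^sup>2 / 2)))"
    using card by (simp only: exp_le_cancel_iff neg_le_iff_le) (intro mult_right_mono, auto)
  finally show ?thesis .
qed

section \<open>The cosine-power kernel\<close>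

lemma exists_signs_cos_power_ge:
  fixes P :: "nat set" and y Q R B :: real
  assumes "finite P" "\<And>p. p \<in> P \<Longrightarrow> Q \<le> real p" "Q > 0" "R > 0" "\<bar>y\<bar> \<le> 1 / Q" "B \<ge> 0"
    and B: "\<And>u. Q / 2 < u \<Longrightarrow> u \<le> real M / R \<Longrightarrow> (\<Prod>p\<in>P. \<bar>cos (pi * (u / real p))\<bar>) \<le> B"
  shows "\<exists>s :: nat \<Rightarrow> real. (\<forall>p. s p \<in> {-1, 1}) \<and>
    1 / (2 * real M + 1) - B \<le> cos (pi * ((y + (\<Sum>p\<in>P. s p / real p)) / (2 * R))) ^ (2 * M)"
proof -
  \<comment> \<open>Fourier coefficients and frequencies of the kernel: the weights
    \<open>c j\<close> are nonnegative with sum 1, and \<open>j = M\<close> is frequency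
    zero.\<close>
  define c where "c j = real ((2 * M) choose j) / 4 ^ M" for j
  define \<omega> where "\<omega> j = pi * ((real j - real M) / R)" for j
  have c0: "c j \<ge> 0" for j by (simp add: c_def)
  have "(\<Sum>j\<le>2*M. c j) = real (\<Sum>j\<le>2*M. (2 * M) choose j) / 4 ^ M"
    by (simp add: c_def sum_divide_distrib)
  also have "\<dots> = 1" by (subst choose_row_sum) (simp add: power_mult)
  finally have c_sum: "(\<Sum>j\<le>2*M. c j) = 1" .
  have "real (4 ^ M) \<le> real (Suc (2 * M) * ((2 * M) choose M))"
    using four_power_le_central_binomial of_nat_le_iff by blast
  then have cM: "1 / (2 * real M + 1) \<le> c M"
    by (simp add: c_def field_simps)
  have expand: "cos (pi * (Y / (2 * R))) ^ (2 * M) = (\<Sum>j\<le>2*M. c j * cos (\<omega> j * Y))" for Y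
  proof -
    have "4 ^ M * cos (pi * (Y / (2 * R))) ^ (2 * M) = (2 * cos (pi * (Y / (2 * R)))) ^ (2 * M)"
      by (simp add: power_mult_distrib power_mult)
    also have "\<dots> = (\<Sum>j\<le>2*M. real ((2 * M) choose j) * cos (\<omega> j * Y))"
    proof -
      have "(2 * real j - real (2 * M)) * (pi * (Y / (2 * R))) = \<omega> j * Y" for j
        using assms(4) by (simp add: \<omega>_def divide_simps)
      then show ?thesis by (simp only: two_cos_power)
    qed
    finally have "cos (pi * (Y / (2 * R))) ^ (2 * M)
        = (\<Sum>j\<le>2*M. real ((2 * M) choose j) * cos (\<omega> j * Y)) / 4 ^ M"
      by (simp only: eq_divide_eq) (simp add: mult.commute)
    then show ?thesis by (simp add: c_def sum_divide_distrib)
  qed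
  \<comment> \<open>The loss \<open>c j * B\<close> is granted to every \<open>j\<close>, although
    only high frequencies can incur it, so that the losses add up to \<open>B\<close>.\<close>
  have term_ge: "(if j = M then c M else 0) - c j * B
      \<le> c j * cos (\<omega> j * y) * (\<Prod>p\<in>P. cos (\<omega> j * (1 / real p)))" if "j \<le> 2 * M" for j
  proof (cases "j = M")
    case True
    then show ?thesis using c0[of M] assms(6) by (simp add: \<omega>_def)
  next
    case False
    define u where "u = \<bar>real j - real M\<bar> / R"
    have \<omega>: "\<bar>\<omega> j\<bar> = pi * u" using assms(4) by (simp add: \<omega>_def u_def abs_mult)
    have u0: "u \<ge> 0" using assms(4) by (simp add: u_def)
    show ?thesis
    proof (cases "u \<le> Q / 2")
      case True
      \<comment> \<open>The cutoff \<open>Q / 2\<close> keeps the angle within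
        \<open>pi / 2\<close>, both for \<open>z = y\<close> and for
        \<open>z = 1 / p\<close>.\<close>
      have nonneg: "0 \<le> cos (\<omega> j * z)" if "\<bar>z\<bar> \<le> 1 / Q" for z
      proof -
        have "u * \<bar>z\<bar> \<le> Q / 2 * (1 / Q)" using True that u0 assms(3) by (intro mult_mono) auto
        then have "pi * (u * \<bar>z\<bar>) \<le> pi * (1 / 2)" using assms(3) by (intro mult_left_mono) auto
        then have "\<bar>\<omega> j * z\<bar> \<le> pi / 2" by (simp add: abs_mult \<omega> mult_ac)
        then show ?thesis by (intro cos_ge_zero) linarith+
      qed
      have "0 \<le> c j * cos (\<omega> j * y) * (\<Prod>p\<in>P. cos (\<omega> j * (1 / real p)))"
        using assms by (intro mult_nonneg_nonneg c0 nonneg prod_nonneg)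
          (auto intro!: divide_left_mono mult_pos_pos dest: assms(2))
      moreover have "0 \<le> c j * B" using c0 assms(6) by simp
      ultimately show ?thesis using False by simp
    next
      case u: False
      have "u \<le> real M / R"
        unfolding u_def using that assms(4) by (intro divide_right_mono) auto
      have "cos (\<omega> j * (1 / real p)) = cos (pi * (u / real p)) " for p
        using cos_abs_real[of "\<omega> j * (1 / real p)"] by (simp add: abs_mult \<omega>)
      then have "\<bar>\<Prod>p\<in>P. cos (\<omega> j * (1 / real p))\<bar> \<le> B"
        using B[OF _ \<open>u \<le> real M / R\<close>] u by (simp add: abs_prod)
      then have "\<bar>cos (\<omega> j * y)\<bar> * \<bar>\<Prod>p\<in>P. cos (\<omega> j * (1 / real p))\<bar> \<le> 1 * B"
        by (intro mult_mono) auto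
      then have "- B \<le> cos (\<omega> j * y) * (\<Prod>p\<in>P. cos (\<omega> j * (1 / real p)))"
        unfolding abs_mult[symmetric] by linarith
      then have "c j * (- B) \<le> c j * (cos (\<omega> j * y) * (\<Prod>p\<in>P. cos (\<omega> j * (1 / real p))))"
        by (intro mult_left_mono c0)
      then show ?thesis using False by (simp add: mult.assoc)
    qed
  qed
  have "1 / (2 * real M + 1) - B \<le> c M - (\<Sum>j\<le>2*M. c j) * B" using cM c_sum by simp
  also have "\<dots> = (\<Sum>j\<le>2*M. (if j = M then c M else 0) - c j * B)"
    by (simp add: sum_subtractf sum_distrib_right)
  also have "\<dots> \<le> (\<Sum>j\<le>2*M. c j * cos (\<omega> j * y) * (\<Prod>p\<in>P. cos (\<omega> j * (1 / real p))))"
    using term_ge by (intro sum_mono) auto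
  finally have lower: "1 / (2 * real M + 1) - B
      \<le> (\<Sum>j\<le>2*M. c j * cos (\<omega> j * y) * (\<Prod>p\<in>P. cos (\<omega> j * (1 / real p))))" .
  from exists_signs_cos_sum_ge[OF assms(1), where c = c and J = "{..2*M}" and \<omega> = \<omega>
      and y = y and g = "\<lambda>p. 1 / real p"]
  obtain s :: "nat \<Rightarrow> real" where "\<And>p. s p \<in> {-1, 1}"
    "(\<Sum>j\<le>2*M. c j * cos (\<omega> j * y) * (\<Prod>p\<in>P. cos (\<omega> j * (1 / real p))))
      \<le> (\<Sum>j\<le>2*M. c j * cos (\<omega> j * (y + (\<Sum>p\<in>P. s p * (1 / real p)))))"
    by blast
  then show ?thesis using lower unfolding expand by (intro exI[of _ s]) auto
qed

text \<open>Since \<open>\<bar>Y\<bar> \<le> R\<close>, only the peak of the kernel at 0 is in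
  range, and there the kernel lies below the Gaussian
  \<open>exp (- M * (Y / (2 * R))\<^sup>2)\<close>.\<close>

lemma square_le_of_cos_power_ge:
  assumes "\<bar>Y\<bar> \<le> R" "R > 0" "L > 0" "M > 0" "1 / L \<le> cos (pi * (Y / (2 * R))) ^ (2 * M)"
  shows "Y\<^sup>2 \<le> 4 * R\<^sup>2 * ln L / real M"
proof -
  define w where "w = Y / (2 * R)"
  have "\<bar>w\<bar> \<le> 1 / 2" using assms(1,2) by (simp add: w_def field_simps)
  have "1 / L \<le> ((cos (pi * w))\<^sup>2) ^ M" using assms(5) by (simp add: w_def power_mult)
  also have "\<dots> \<le> exp (- (w\<^sup>2)) ^ M"
    by (intro power_mono cos_squared_le_exp \<open>\<bar>w\<bar> \<le> _\<close>) auto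
  also have "\<dots> = exp (- (real M * w\<^sup>2))" by (simp flip: exp_of_nat_mult)
  finally have "ln (1 / L) \<le> ln (exp (- (real M * w\<^sup>2)))"
    using assms(3) by (intro ln_mono) auto
  then have "real M * w\<^sup>2 \<le> ln L" using assms(3) by (simp add: ln_div)
  then show ?thesis using assms by (simp add: w_def field_simps power2_eq_square)
qed

section \<open>Choice of parameters and conclusion\<close>

lemma card_large_primes_ge:
  fixes Q :: real
  assumes "n \<ge> 2" "Q \<ge> 0"
  shows "(real n - 2) * ln 2 / ln (real n) - Q - 1 \<le> real (card {p. prime p \<and> Q \<le> real p \<and> p \<le> n})"
proof -
  have fin: "finite {p. prime p \<and> Q \<le> real p \<and> p \<le> n}"
    by (rule finite_subset[of _ "{..n}"]) auto
  have "Q \<le> real p" if "\<not> p < nat \<lceil>Q\<rceil>" for p using that by linarith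
  then have "{p. prime p \<and> p \<le> n} \<subseteq> {p. prime p \<and> Q \<le> real p \<and> p \<le> n} \<union> {..<nat \<lceil>Q\<rceil>}"
    by auto
  then have "card {p. prime p \<and> p \<le> n}
      \<le> card ({p. prime p \<and> Q \<le> real p \<and> p \<le> n} \<union> {..<nat \<lceil>Q\<rceil>})"
    using fin by (intro card_mono) auto
  also have "\<dots> \<le> card {p. prime p \<and> Q \<le> real p \<and> p \<le> n} + nat \<lceil>Q\<rceil>"
    using card_Un_le[of _ "{..<nat \<lceil>Q\<rceil>}"] by simp
  finally have "real (card {p. prime p \<and> p \<le> n})
      \<le> real (card {p. prime p \<and> Q \<le> real p \<and> p \<le> n}) + real (nat \<lceil>Q\<rceil>)"
    by linarith
  moreover have "real (nat \<lceil>Q\<rceil>) \<le> Q + 1" using assms(2) by linarith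
  ultimately show ?thesis using prime_count_ge[OF assms(1)] by linarith
qed

text \<open>The first bound holds because \<open>2/3 + b < 1\<close>, so primes outnumber the
  exceptional ones; the last because \<open>a < b\<close> lets \<open>exp (x powr b)\<close> absorb
  the polynomial factors.\<close>

lemma eventually_parameters:
  fixes a b :: real
  assumes "0 < a" "a < b" "b < 1 / 3"
  shows "\<forall>\<^sub>F x::real in at_top.
    10 * (x powr (2/3) * x powr b) \<le> (x - 2) * ln 2 / ln x - x powr (5/6) - 1 \<and>
    2 * x powr (2/3) < x powr (5/6) \<and> 1 \<le> ln (x powr (5/6)) \<and> x powr (5/6) \<le> x - 1 \<and>
    10 \<le> exp (x powr b) \<and> 1 \<le> x powr b \<and>
    4 * x\<^sup>2 * ln (10 * exp (x powr b)) / exp (x powr b) \<le> exp (- (x powr a)) ^ 2"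
proof (intro eventually_conj)
  show "\<forall>\<^sub>F x::real in at_top. 10 * (x powr (2/3) * x powr b) \<le> (x - 2) * ln 2 / ln x - x powr (5/6) - 1"
    using assms by real_asymp
  show "\<forall>\<^sub>F x::real in at_top. 2 * x powr (2/3) < x powr (5/6)" by real_asymp
  show "\<forall>\<^sub>F x::real in at_top. 1 \<le> ln (x powr (5/6))" by real_asymp
  show "\<forall>\<^sub>F x::real in at_top. x powr (5/6) \<le> x - 1" by real_asymp
  show "\<forall>\<^sub>F x::real in at_top. 10 \<le> exp (x powr b)" using assms by real_asymp
  show "\<forall>\<^sub>F x::real in at_top. 1 \<le> x powr b" using assms by real_asymp
  show "\<forall>\<^sub>F x::real in at_top.
      4 * x\<^sup>2 * ln (10 * exp (x powr b)) / exp (x powr b) \<le> exp (- (x powr a)) ^ 2"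
    using assms by real_asymp
qed

lemma exists_prime_signs:
  fixes N :: nat and a b y :: real
  defines "x \<equiv> real N"
  defines "P \<equiv> {p. prime p \<and> x powr (5/6) \<le> real p \<and> p \<le> N}"
  assumes N: "N \<ge> 2" and y: "\<bar>y\<bar> \<le> 1 / (x - 1)"
    and many: "10 * (x powr (2/3) * x powr b) \<le> (x - 2) * ln 2 / ln x - x powr (5/6) - 1"
    and powr: "2 * x powr (2/3) < x powr (5/6)" "1 \<le> ln (x powr (5/6))" "x powr (5/6) \<le> x - 1"
    and exp: "10 \<le> exp (x powr b)" "1 \<le> x powr b"
    and small: "4 * x\<^sup>2 * ln (10 * exp (x powr b)) / exp (x powr b) \<le> exp (- (x powr a)) ^ 2"
  shows "\<exists>s :: nat \<Rightarrow> real. (\<forall>p. s p \<in> {-1, 1}) \<and>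
    \<bar>y + (\<Sum>p\<in>P. s p / real p)\<bar> \<le> exp (- (x powr a))"
proof -
  define Q where "Q = x powr (5/6)"
  \<comment> \<open>\<open>h\<close> is the half-width of the window around \<open>u\<close>, and
    \<open>t\<close>, rounded up to \<open>M\<close>, sets the degree of the kernel.\<close>
  define h where "h = x powr (2/3)"
  define t where "t = exp (x powr b)"
  define M where "M = nat \<lceil>t\<rceil>"
  have x: "x \<ge> 2" using N by (simp add: x_def)
  have "finite P" unfolding P_def by (rule finite_subset[of _ "{..N}"]) auto
  have Q: "0 < Q" "1 \<le> ln Q" "2 * h < Q" "Q \<le> x - 1" and h: "1 \<le> h"
    using x powr by (auto simp: Q_def h_def ge_one_powr_ge_zero)
  have t: "10 \<le> t" "ln t = x powr b" using exp by (auto simp: t_def)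
  have M: "t \<le> real M" "real M \<le> t + 1" unfolding M_def using t(1) by linarith+
  have "ln (real M) \<le> ln (t * exp 1)"
  proof (rule ln_mono)
    have "t * 2 \<le> t * exp 1" using exp_ge_add_one_self[of 1] t by (intro mult_left_mono) auto
    then show "real M \<le> t * exp 1" using M t by linarith
  qed (use M t in auto)
  also have "\<dots> = x powr b + 1" using t by (simp add: ln_mult)
  finally have lnM: "ln (real M) \<le> 2 * x powr b" using exp by linarith

  have B: "(\<Prod>p\<in>P. \<bar>cos (pi * (u / real p))\<bar>) \<le> 1 / t\<^sup>2" if u: "Q / 2 < u" "u \<le> real M / x" for u
  proof -
    \<comment> \<open>\<open>u \<le> M / 2\<close> and \<open>h < Q / 2 < u\<close>, so the whole
      window stays below \<open>M\<close>.\<close>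
    have "real M / x \<le> real M / 2" using x by (intro divide_left_mono) auto
    then have "u + h \<le> real M" using u Q by linarith
    then have "(\<Prod>p\<in>P. \<bar>cos (pi * (u / real p))\<bar>)
        \<le> exp (- ((real (card P) - (2 * h + 1) * ln (real M)) * ((h / x)\<^sup>2 / 2)))"
      using \<open>finite P\<close> Q h u M t
      by (intro prod_abs_cos_le_exp[where Q = Q]) (auto simp: P_def Q_def x_def)
    also have "\<dots> \<le> exp (- (2 * x powr b))"
    proof -
      \<comment> \<open>At most \<open>6 * h * x powr b\<close> primes are exceptional, out of at
        least 10 times \<open>h * x powr b\<close>.\<close>
      have "(2 * h + 1) * ln (real M) \<le> (3 * h) * (2 * x powr b)"
        using lnM h M t by (intro mult_mono) auto
      moreover have "10 * (h * x powr b) \<le> real (card P)"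
        using many card_large_primes_ge[OF N, of Q] Q unfolding P_def x_def Q_def h_def by linarith
      ultimately have "4 * (h * x powr b) \<le> real (card P) - (2 * h + 1) * ln (real M)" by simp
      then have "4 * (h * x powr b) * ((h / x)\<^sup>2 / 2)
          \<le> (real (card P) - (2 * h + 1) * ln (real M)) * ((h / x)\<^sup>2 / 2)"
        by (intro mult_right_mono) auto
      \<comment> \<open>The exponent \<open>2/3\<close> gives
        \<open>h * (h / x)\<^sup>2 = 1\<close>, so the decay is exactly
        \<open>2 * x powr b\<close>.\<close>
      moreover have "h powr 3 = x powr 2" by (simp add: h_def powr_powr)
      then have "h ^ 3 = x\<^sup>2" using x h by simp
      then have "4 * (h * x powr b) * ((h / x)\<^sup>2 / 2) = 2 * x powr b"
        using x by (simp add: power2_eq_square power3_eq_cube field_simps)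
      ultimately show ?thesis by (simp only: exp_le_cancel_iff neg_le_iff_le)
    qed
    also have "\<dots> = 1 / t\<^sup>2"
      by (simp add: t_def exp_minus inverse_eq_divide flip: exp_of_nat_mult)
    finally show ?thesis .
  qed
  have yQ: "\<bar>y\<bar> \<le> 1 / Q"
    using Q x by (intro order.trans[OF y] divide_left_mono) auto
  have "\<exists>s :: nat \<Rightarrow> real. (\<forall>p. s p \<in> {-1, 1}) \<and> 1 / (2 * real M + 1) - 1 / t\<^sup>2
               \<le> cos (pi * ((y + (\<Sum>p\<in>P. s p / real p)) / (2 * x))) ^ (2 * M)"
    by (rule exists_signs_cos_power_ge[OF \<open>finite P\<close> _ Q(1) _ yQ _ B])
      (use x in \<open>auto simp: P_def Q_def\<close>)
  then obtain s :: "nat \<Rightarrow> real" where s: "\<And>p. s p \<in> {-1, 1}"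
    and ge: "1 / (2 * real M + 1) - 1 / t\<^sup>2
               \<le> cos (pi * ((y + (\<Sum>p\<in>P. s p / real p)) / (2 * x))) ^ (2 * M)"
    by blast
  define Y where "Y = y + (\<Sum>p\<in>P. s p / real p)"
  \<comment> \<open>A crude bound, enough to confine \<open>Y\<close> to \<open>[-x, x]\<close>:
    \<open>P\<close> lies in \<open>{2..N}\<close>, which leaves room 1 for
    \<open>y\<close>.\<close>
  have "\<bar>\<Sum>p\<in>P. s p / real p\<bar> \<le> (\<Sum>p\<in>P. 1)"
  proof (intro order.trans[OF sum_abs] sum_mono)
    fix p assume "p \<in> P"
    then have "real p \<ge> 1" by (auto simp: P_def Suc_le_eq prime_gt_0_nat)
    moreover have "\<bar>s p\<bar> = 1" using s[of p] by auto
    ultimately show "\<bar>s p / real p\<bar> \<le> 1" by (simp add: divide_le_eq)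
  qed
  also have "\<dots> = real (card P)" by simp
  also have "\<dots> \<le> real (card {2..N})"
    by (intro of_nat_mono card_mono) (auto simp: P_def prime_ge_2_nat)
  also have "\<dots> = x - 1" using N by (simp add: x_def of_nat_diff)
  finally have "\<bar>\<Sum>p\<in>P. s p / real p\<bar> \<le> x - 1" .
  moreover have "1 / (x - 1) \<le> 1" using x by simp
  ultimately have "\<bar>Y\<bar> \<le> x" using y unfolding Y_def by linarith
  \<comment> \<open>Uses \<open>10 \<le> t\<close>, and then
    \<open>2 * M + 1 \<le> 2 * t + 3 \<le> 5 * t\<close>.\<close>
  have "1 / (10 * t) \<le> 1 / (5 * t) - 1 / t\<^sup>2"
    using t by (simp add: field_simps power2_eq_square)
  also have "\<dots> \<le> 1 / (2 * real M + 1) - 1 / t\<^sup>2"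
    using M t by (intro diff_right_mono divide_left_mono) auto
  finally have "Y\<^sup>2 \<le> 4 * x\<^sup>2 * ln (10 * t) / real M"
    using ge \<open>\<bar>Y\<bar> \<le> x\<close> x M t unfolding Y_def[symmetric]
    by (intro square_le_of_cos_power_ge) auto
  also have "\<dots> \<le> 4 * x\<^sup>2 * ln (10 * t) / t"
    using M t by (intro divide_left_mono mult_nonneg_nonneg mult_pos_pos) auto
  also have "\<dots> \<le> exp (- (x powr a)) ^ 2" using small by (simp only: t_def)
  finally have "\<bar>Y\<bar> \<le> exp (- (x powr a))"
    using abs_le_square_iff[of Y "exp (- (x powr a))"] by simp
  then show ?thesis using s unfolding Y_def by blast
qed

theorem corollary1p1:
  fixes \<tau> \<epsilon> :: real
  assumes "\<epsilon> > 0"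
  shows "\<exists>C::real. C > 0 \<and> (\<exists>N\<^sub>0::nat. \<forall>N\<ge>N\<^sub>0. \<exists>s :: nat \<Rightarrow> real.
           (\<forall>n\<in>{1..N}. s n \<in> {-1, 1}) \<and>
           \<bar>(\<Sum>n=1..N. s n / real n) - \<tau>\<bar> \<le> C * exp (- (real N powr (1/3 - \<epsilon>))))"
proof -
  \<comment> \<open>Capping at \<open>1/6\<close> keeps the exponent \<open>a\<close> positive; a
    smaller \<open>\<epsilon>\<close> only strengthens the bound.\<close>
  define e where "e = min \<epsilon> (1/6)"
  have e: "0 < e" "e \<le> \<epsilon>" "e \<le> 1/6" using assms by (auto simp: e_def)
  define a b where "a = 1/3 - e" and "b = 1/3 - e/2"
  have ab: "0 < a" "a < b" "b < 1/3" using e by (auto simp: a_def b_def)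
  have "\<forall>\<^sub>F N in sequentially. \<exists>s :: nat \<Rightarrow> real. (\<forall>n\<in>{1..N}. s n \<in> {-1, 1}) \<and>
      \<bar>(\<Sum>n=1..N. s n / real n) - \<tau>\<bar> \<le> 1 * exp (- (real N powr (1/3 - \<epsilon>)))"
    using eventually_compose_filterlim[OF eventually_parameters[OF ab] filterlim_real_sequentially]
      greedy_signs_small_error[of \<tau>] eventually_ge_at_top[of 5]
  proof eventually_elim
    case (elim N)
    define Q where "Q = real N powr (5/6)"
    define P where "P = {p. prime p \<and> Q \<le> real p \<and> p \<le> N}"
    \<comment> \<open>\<open>2 < Q\<close> excludes the prime 2, so the complement of
      \<open>P\<close> contains all even numbers, as the greedy step requires.\<close>
    have "1 \<le> real N powr (2/3)" using elim(3) by (intro ge_one_powr_ge_zero) auto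
    then have "2 < Q" using elim(1) unfolding Q_def by linarith
    have "n \<in> - P" if "even n" for n
    proof
      assume "n \<in> P"
      then have "prime n" "2 < n" using \<open>2 < Q\<close> by (auto simp: P_def)
      then show False using that prime_odd_nat by blast
    qed
    then obtain s1 :: "nat \<Rightarrow> real" where s1: "\<And>n. s1 n \<in> {-1, 1}"
      "\<bar>(\<Sum>n\<in>{1..N} \<inter> - P. s1 n / real n) - \<tau>\<bar> \<le> 1 / (real N - 1)"
      using elim(2) by blast
    have "\<exists>s :: nat \<Rightarrow> real. (\<forall>p. s p \<in> {-1, 1}) \<and>
        \<bar>((\<Sum>n\<in>{1..N} \<inter> - P. s1 n / real n) - \<tau>) + (\<Sum>p\<in>P. s p / real p)\<bar>
          \<le> exp (- (real N powr a))"
      unfolding P_def Q_def using elim s1(2)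
      by (intro exists_prime_signs[where b = b]) (auto simp: P_def Q_def)
    then obtain s2 :: "nat \<Rightarrow> real" where s2: "\<And>n. s2 n \<in> {-1, 1}"
      "\<bar>((\<Sum>n\<in>{1..N} \<inter> - P. s1 n / real n) - \<tau>) + (\<Sum>p\<in>P. s2 p / real p)\<bar>
         \<le> exp (- (real N powr a))" by blast
    define s where "s n = (if n \<in> P then s2 n else s1 n)" for n
    have "P \<subseteq> {1..N}" by (auto simp: P_def Suc_le_eq prime_gt_0_nat)
    then have "(\<Sum>n=1..N. s n / real n) = (\<Sum>n\<in>{1..N} \<inter> - P. s n / real n) + (\<Sum>p\<in>P. s p / real p)"
      by (metis Diff_eq finite_atLeastAtMost sum.subset_diff)
    also have "\<dots> = (\<Sum>n\<in>{1..N} \<inter> - P. s1 n / real n) + (\<Sum>p\<in>P. s2 p / real p)"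
      by (simp add: s_def)
    finally have "\<bar>(\<Sum>n=1..N. s n / real n) - \<tau>\<bar> \<le> exp (- (real N powr a))"
      using s2(2) by (simp add: algebra_simps)
    also have "\<dots> \<le> exp (- (real N powr (1/3 - \<epsilon>)))"
      using e elim(3) by (simp add: a_def powr_mono)
    finally show ?case using s1(1) s2(1) by (intro exI[of _ s]) (simp add: s_def)
  qed
  then show ?thesis unfolding eventually_sequentially by (intro exI[of _ 1]) auto
qed

end
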